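(* For every $n\ge 1$, let $G_n^7$ be the graph on vertex set $\{a,b,c,d\}\cup\{1,2,\dots,n\}\cup\{x\}$ with the following edges: among $\{a,b,c,d\}$ exactly the edges $\{a,c\},\{a,d\},\{b,d\}$; among $\{1,\dots,n\}$ every pair $\{i,j\}$ with $|i-j|\ge 2$ (so the only non-edges there are $\{i,i+1\}$, $1\le i\le n-1$); the edges $\{x,i\}$ for all $1\le i\le n$, and $\{x,a\}$, $\{x,d\}$; the edges $\{a,i\}$ for all $2\le i\le n$; and the edges $\{d,i\}$ for all $1\le i\le n-1$. There are no other edges (in particular $b$ and $c$ have no neighbours outside $\{a,b,c,d\}$). Then $G_n^7$ is word-representable.
   Context: All graphs are finite and simple. For a word $w$ and letters $i,j$, let $w_{ij}$ be the subsequence of $w$ consisting of all occurrences of $i$ and $j$; $i$ and $j$ alternate in $w$ if $w_{ij}$ contains no factor $ii$ or $jj$. A graph $G$ is word-representable if there is a word $w$ over $V(G)$ such that for all distinct $i,j\in V(G)$, $\{i,j\}\in E(G)$ if and only if $i$ and $j$ alternate in $w$. *)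

theory Defs
  imports Main "HOL-Library.Sublist"
begin

text \<open>Finite simple graphs are given by a vertex set and a set of two-element edges.\<close>

definition simple_graph :: "'a set \<Rightarrow> 'a set set \<Rightarrow> bool" where
  "simple_graph V E \<longleftrightarrow> finite V \<and> (\<forall>e\<in>E. e \<subseteq> V \<and> card e = 2)"

definition restrict_word :: "'a list \<Rightarrow> 'a \<Rightarrow> 'a \<Rightarrow> 'a list" where
  "restrict_word w i j = filter (\<lambda>k. k = i \<or> k = j) w"

definition alternate :: "'a list \<Rightarrow> 'a \<Rightarrow> 'a \<Rightarrow> bool" where
  "alternate w i j \<longleftrightarrow>
     \<not> sublist [i, i] (restrict_word w i j) \<and> \<not> sublist [j, j] (restrict_word w i j)"

text \<open>A word over \<open>V\<close> need not use every letter of \<open>V\<close>. Insisting that it does gives the same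
  notion, see \<open>word_representable_iff_all_letters\<close>.\<close>

definition word_representable :: "'a set \<Rightarrow> 'a set set \<Rightarrow> bool" where
  "word_representable V E \<longleftrightarrow>
     (\<exists>w. set w \<subseteq> V \<and> (\<forall>i\<in>V. \<forall>j\<in>V. i \<noteq> j \<longrightarrow> ({i, j} \<in> E \<longleftrightarrow> alternate w i j)))"

datatype vertex = VA | VB | VC | VD | VX | Num nat

definition G7_verts :: "nat \<Rightarrow> vertex set" where
  "G7_verts n = {VA, VB, VC, VD} \<union> Num ` {1..n} \<union> {VX}"

definition G7_edges :: "nat \<Rightarrow> vertex set set" where
  "G7_edges n =
     {{VA, VC}, {VA, VD}, {VB, VD}}
     \<union> {{Num i, Num j} | i j. i \<in> {1..n} \<and> j \<in> {1..n} \<and> \<bar>int i - int j\<bar> \<ge> 2}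
     \<union> {{VX, Num i} | i. i \<in> {1..n}}
     \<union> {{VX, VA}, {VX, VD}}
     \<union> {{VA, Num i} | i. i \<in> {2..n}}
     \<union> {{VD, Num i} | i. 1 \<le> i \<and> i + 1 \<le> n}"

lemma simple_graph_G7: "simple_graph (G7_verts n) (G7_edges n)"
  unfolding simple_graph_def G7_verts_def G7_edges_def
  by (auto simp: card_insert_if)

lemma sublist_Cons_same:
  "sublist [j, j] (m # u) \<longleftrightarrow> (m = j \<and> u \<noteq> [] \<and> hd u = j) \<or> sublist [j, j] u"
  by (cases u) (auto simp: sublist_Cons_right)

lemma alternate_Cons_new:
  assumes "m \<notin> set w" "i \<noteq> j"
  shows "alternate (m # w) i j \<longleftrightarrow> alternate w i j"
proof (cases "m = i \<or> m = j")
  case True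
  have "hd (restrict_word w i j) \<noteq> m" if "restrict_word w i j \<noteq> []"
    using assms(1) hd_in_set[OF that] by (auto simp: restrict_word_def)
  with True assms show ?thesis
    by (auto simp: alternate_def restrict_word_def sublist_Cons_same)
qed (simp add: alternate_def restrict_word_def)

lemma alternate_append_new:
  assumes "distinct ms" "set ms \<inter> set w = {}" "i \<noteq> j"
  shows "alternate (ms @ w) i j \<longleftrightarrow> alternate w i j"
  using assms by (induction ms) (auto simp: alternate_Cons_new)

lemma word_representable_iff_all_letters:
  assumes "finite V"
  shows "word_representable V E \<longleftrightarrow>
    (\<exists>w. set w = V \<and> (\<forall>i\<in>V. \<forall>j\<in>V. i \<noteq> j \<longrightarrow> ({i, j} \<in> E \<longleftrightarrow> alternate w i j)))"
proof
  assume "word_representable V E"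
  then obtain w where w: "set w \<subseteq> V"
    "\<forall>i\<in>V. \<forall>j\<in>V. i \<noteq> j \<longrightarrow> ({i, j} \<in> E \<longleftrightarrow> alternate w i j)"
    unfolding word_representable_def by blast
  obtain ms where ms: "set ms = V - set w" "distinct ms"
    using finite_distinct_list[of "V - set w"] assms by auto
  have "set (ms @ w) = V" using ms w(1) by auto
  moreover have "alternate (ms @ w) i j \<longleftrightarrow> alternate w i j" if "i \<noteq> j" for i j
    using ms that by (intro alternate_append_new) auto
  ultimately show "\<exists>w. set w = V \<and>
      (\<forall>i\<in>V. \<forall>j\<in>V. i \<noteq> j \<longrightarrow> ({i, j} \<in> E \<longleftrightarrow> alternate w i j))"
    using w(2) by (intro exI[of _ "ms @ w"]) simp
qed (auto simp: word_representable_def)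

end

theory Submission
  imports Defs
begin

text \<open>Off the pendant vertices \<open>b\<close> and \<open>c\<close>, the graph is the complement of the path
  \<open>a, 1, \<dots>, n, d\<close> together with the dominating vertex \<open>x\<close>. A path is a permutation graph,
  hence so is its complement: numbering the path \<open>0, \<dots>, n + 1\<close>, the orders
  \<open>1 0 3 2 5 4 \<dots>\<close> and \<open>0 2 1 4 3 6 5 \<dots>\<close> disagree exactly on consecutive numbers.
  Writing \<open>x\<close> in front of both and concatenating represents the graph by a word in which every
  letter occurs twice. In such a word a pendant vertex \<open>c\<close> at \<open>a\<close> is added by replacing the first
  \<open>a\<close> by \<open>c a c\<close>: no other letter separates the two \<open>c\<close>s.\<close>

section \<open>Two-uniform words and the addition of pendant vertices\<close>

text \<open>\<open>E\<close> is tested only on pairs inside \<open>V\<close>, so the word represents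
  the subgraph induced on \<open>V\<close>; this lets \<open>V\<close> grow while \<open>E\<close>
  stays fixed.\<close>

definition two_uniform_represents :: "'a list \<Rightarrow> 'a set \<Rightarrow> 'a set set \<Rightarrow> bool" where
  "two_uniform_represents w V E \<longleftrightarrow> set w \<subseteq> V \<and> (\<forall>v\<in>V. count_list w v = 2) \<and>
     (\<forall>i\<in>V. \<forall>j\<in>V. i \<noteq> j \<longrightarrow> ({i, j} \<in> E \<longleftrightarrow> alternate w i j))"

lemma two_uniform_represents_imp_word_representable:
  "two_uniform_represents w V E \<Longrightarrow> word_representable V E"
  unfolding two_uniform_represents_def word_representable_def by blast

lemma alternate_commute: "alternate w i j \<longleftrightarrow> alternate w j i"
  by (auto simp: alternate_def restrict_word_def disj_commute)

lemma count_list_eq_length_filter_eq: "count_list xs a = length (filter (\<lambda>k. k = a) xs)"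
  by (induction xs) auto

lemma filter_eq_singleton:
  assumes "count_list xs a = 1"
  shows "filter (\<lambda>k. k = a) xs = [a]"
proof -
  have "length (filter (\<lambda>k. k = a) xs) = 1"
    using assms by (simp add: count_list_eq_length_filter_eq)
  then obtain y where "filter (\<lambda>k. k = a) xs = [y]"
    by (auto simp: length_Suc_conv)
  moreover from this have "y = a"
    using filter_set[of "\<lambda>k. k = a" xs] by force
  ultimately show ?thesis by simp
qed

lemma count_list_distinct:
  assumes "distinct xs" "a \<in> set xs"
  shows "count_list xs a = 1"
  using assms by (induction xs) auto

text \<open>Restricted to \<open>a\<close> and \<open>c\<close> the new word reads
  \<open>c a c a\<close>, while restricting to \<open>c\<close> and any other letter erases the
  \<open>a\<close> and leaves a factor \<open>c c\<close>. The new word is again two-uniform, so the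
  step can be iterated.\<close>

lemma two_uniform_represents_pendant:
  assumes w: "two_uniform_represents w V E" and "a \<in> V" "c \<notin> V"
    and E: "\<And>v. v \<in> V \<Longrightarrow> {v, c} \<in> E \<longleftrightarrow> v = a"
  shows "\<exists>w'. two_uniform_represents w' (insert c V) E"
proof -
  have "set w \<subseteq> V" and count: "\<And>v. v \<in> V \<Longrightarrow> count_list w v = 2"
    and alt: "\<And>i j. i \<in> V \<Longrightarrow> j \<in> V \<Longrightarrow> i \<noteq> j \<Longrightarrow> {i, j} \<in> E \<longleftrightarrow> alternate w i j"
    using w by (auto simp: two_uniform_represents_def)
  have "a \<in> set w"
    using count[OF \<open>a \<in> V\<close>] count_notin[of a w] by fastforce
  then obtain u v where uv: "w = u @ a # v" "a \<notin> set u"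
    by (meson split_list_first)
  have c: "c \<notin> set u" "c \<notin> set v" "c \<noteq> a"
    using \<open>set w \<subseteq> V\<close> \<open>c \<notin> V\<close> \<open>a \<in> V\<close> uv by auto
  define w' where "w' = u @ [c, a, c] @ v"
  have old: "alternate w' i j \<longleftrightarrow> alternate w i j" if "i \<noteq> c" "j \<noteq> c" for i j
    using that by (simp add: alternate_def restrict_word_def w'_def uv)
  \<comment> \<open>The split is at the first \<open>a\<close>, so \<open>u\<close> has none and
    two-uniformity leaves exactly one for \<open>v\<close>.\<close>
  have "count_list v a = 1"
    using count[OF \<open>a \<in> V\<close>] uv by simp
  then have "filter (\<lambda>k. k = a) v = [a]"
    by (rule filter_eq_singleton)
  moreover have "filter (\<lambda>k. k = a \<or> k = c) v = filter (\<lambda>k. k = a) v"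
    using c by (intro filter_cong) auto
  moreover have "filter (\<lambda>k. k = a \<or> k = c) u = []"
    using c uv by (auto simp: filter_empty_conv)
  ultimately have "restrict_word w' a c = [c, a, c, a]"
    by (simp add: restrict_word_def w'_def)
  then have a: "alternate w' a c"
    using c by (auto simp: alternate_def sublist_Cons_same)
  have "\<not> alternate w' i c" if "i \<noteq> a" "i \<noteq> c" for i
  proof -
    have "restrict_word w' i c = restrict_word u i c @ [c, c] @ restrict_word v i c"
      using that c by (simp add: restrict_word_def w'_def)
    then show ?thesis
      by (simp add: alternate_def sublist_def) blast
  qed
  then have new: "{i, c} \<in> E \<longleftrightarrow> alternate w' i c" if "i \<in> V" for i
    using that E a \<open>c \<notin> V\<close> by metis
  have "{i, j} \<in> E \<longleftrightarrow> alternate w' i j" if "i \<in> insert c V" "j \<in> insert c V" "i \<noteq> j" for i j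
    using that new alt old by (metis alternate_commute insert_commute insertE)
  moreover have "set w' \<subseteq> insert c V"
    using \<open>set w \<subseteq> V\<close> by (auto simp: w'_def uv)
  moreover have "count_list w' k = 2" if "k \<in> insert c V" for k
    using that count[of k] c \<open>c \<notin> V\<close> by (auto simp: w'_def uv)
  ultimately show ?thesis
    unfolding two_uniform_represents_def by blast
qed

section \<open>Concatenations of two permutations\<close>

lemma restrict_word_distinct:
  assumes "distinct p" "i \<in> set p" "j \<in> set p" "i \<noteq> j"
  shows "restrict_word p i j = [i, j] \<or> restrict_word p i j = [j, i]"
proof -
  have "distinct (restrict_word p i j)" "set (restrict_word p i j) = {i, j}"
    using assms by (auto simp: restrict_word_def)
  moreover from this have "length (restrict_word p i j) = 2"
    using \<open>i \<noteq> j\<close> by (metis card_2_iff distinct_card)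
  ultimately show ?thesis
    by (auto simp: length_Suc_conv numeral_2_eq_2 doubleton_eq_iff)
qed

text \<open>Each permutation restricts to \<open>i j\<close> or \<open>j i\<close>. Equal orders
  give \<open>i j i j\<close> or \<open>j i j i\<close>; opposite orders give \<open>i j j i\<close>
  or \<open>j i i j\<close>, which repeat a letter in the middle.\<close>

lemma alternate_permutations:
  assumes "distinct p" "distinct q" "set p = set q" "i \<in> set p" "j \<in> set p" "i \<noteq> j"
  shows "alternate (p @ q) i j \<longleftrightarrow> restrict_word p i j = restrict_word q i j"
proof -
  have "restrict_word (p @ q) i j = restrict_word p i j @ restrict_word q i j"
    by (simp add: restrict_word_def)
  then show ?thesis
    using restrict_word_distinct[of p i j] restrict_word_distinct[of q i j] assms
    by (auto simp: alternate_def sublist_Cons_same)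
qed

lemma restrict_word_map:
  assumes "inj_on f (insert i (insert j (set p)))"
  shows "restrict_word (map f p) (f i) (f j) = map f (restrict_word p i j)"
proof -
  have "filter (\<lambda>k. f k = f i \<or> f k = f j) p = filter (\<lambda>k. k = i \<or> k = j) p"
    using assms by (intro filter_cong) (auto simp: inj_on_def)
  then show ?thesis
    by (simp add: restrict_word_def filter_map comp_def)
qed

section \<open>Two orders that disagree exactly on consecutive numbers\<close>

text \<open>The increasing order of \<open>0, ..., m\<close> with the blocks
  \<open>{m - 1, m}\<close>, \<open>{m - 3, m - 2}\<close>, ... reversed, so the parity of
  \<open>m\<close> decides which consecutive pairs are swapped. For even \<open>m\<close> the number
  \<open>0\<close> stands alone.\<close>

fun zigzag :: "nat \<Rightarrow> nat list" where
  "zigzag 0 = [0]"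
| "zigzag (Suc 0) = [1, 0]"
| "zigzag (Suc (Suc m)) = zigzag m @ [Suc (Suc m), Suc m]"

lemma set_zigzag: "set (zigzag m) = {..m}"
  by (induction m rule: zigzag.induct) auto

lemma distinct_zigzag: "distinct (zigzag m)"
  by (induction m rule: zigzag.induct) (auto simp: set_zigzag)

lemma restrict_word_distinct_notin:
  assumes "distinct p" "i \<in> set p" "j \<notin> set p"
  shows "restrict_word p i j = [i]"
proof -
  have "restrict_word p i j = filter (\<lambda>k. k = i) p"
    using assms unfolding restrict_word_def by (intro filter_cong) auto
  then show ?thesis
    using assms by (simp add: filter_eq_singleton count_list_distinct)
qed

text \<open>The reversed blocks are the pairs \<open>j - 1, j\<close> whose top \<open>j\<close> has
  the parity of \<open>m\<close>; all other pairs keep their natural order.\<close>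

lemma restrict_word_zigzag:
  assumes "i < j" "j \<le> m"
  shows "restrict_word (zigzag m) i j = (if j = Suc i \<and> even (m - j) then [j, i] else [i, j])"
  using assms
proof (induction m rule: zigzag.induct)
  case (3 m)
  have app: "restrict_word (zigzag (Suc (Suc m))) i j =
      restrict_word (zigzag m) i j @ restrict_word [Suc (Suc m), Suc m] i j"
    by (simp add: restrict_word_def)
  consider "j \<le> m" | "i \<le> m" "m < j" | "i = Suc m" "j = Suc (Suc m)"
    using 3 by linarith
  then show ?case
  proof cases
    case 1
    then show ?thesis
      using 3 app by (auto simp: restrict_word_def Suc_diff_le)
  next
    case 2
    then have "restrict_word (zigzag m) i j = [i]"
      by (intro restrict_word_distinct_notin) (auto simp: set_zigzag distinct_zigzag)
    \<comment> \<open>If \<open>j = Suc i\<close> here, then \<open>j = Suc m\<close>, at odd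
      distance from \<open>Suc (Suc m)\<close>, so the claimed order is \<open>[i, j]\<close> in
      every subcase.\<close>
    moreover from 2 have "j = Suc m \<or> j = Suc (Suc m)"
      using 3 by auto
    ultimately show ?thesis
      using 2 app by (auto simp: restrict_word_def)
  next
    case 3
    then have "restrict_word (zigzag m) i j = []"
      by (auto simp: restrict_word_def filter_empty_conv set_zigzag)
    then show ?thesis
      using 3 app by (simp add: restrict_word_def)
  qed
qed (auto simp: restrict_word_def)

text \<open>Both words are permutations of \<open>0, ..., Suc m\<close>, and they reverse blocks of
  opposite parity. Hence each consecutive pair is reversed in exactly one of them, the pair
  \<open>m, Suc m\<close> in the second.\<close>

lemma zigzag_agree_iff:
  assumes "i < j" "j \<le> Suc m"
  shows "restrict_word (zigzag m @ [Suc m]) i j = restrict_word (zigzag (Suc m)) i j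
    \<longleftrightarrow> j \<noteq> Suc i"
proof (cases "j \<le> m")
  case True
  then show ?thesis
    using assms restrict_word_zigzag[of i j m] restrict_word_zigzag[of i j "Suc m"]
    by (auto simp: restrict_word_def Suc_diff_le)
next
  case False
  then have j: "j = Suc m"
    using assms by simp
  then have "restrict_word (zigzag m) i j = [i]"
    using assms by (intro restrict_word_distinct_notin) (auto simp: set_zigzag distinct_zigzag)
  then show ?thesis
    using assms j restrict_word_zigzag[of i j "Suc m"]
    by (auto simp: restrict_word_def)
qed

section \<open>The graph without its pendant vertices\<close>

text \<open>Numbers beyond \<open>Suc n\<close> are sent to \<open>Num\<close> as well, which keeps
  the map injective on all natural numbers.\<close>

definition path_vertex :: "nat \<Rightarrow> nat \<Rightarrow> vertex" where
  "path_vertex n k = (if k = 0 then VA else if k = Suc n then VD else Num k)"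

lemma inj_path_vertex: "inj (path_vertex n)"
  by (auto simp: inj_on_def path_vertex_def)

lemma path_vertex_image: "path_vertex n ` {..Suc n} = {VA, VD} \<union> Num ` {1..n}"
proof -
  have "{..Suc n} = {0, Suc n} \<union> {1..n}" by auto
  moreover have "path_vertex n ` {1..n} = Num ` {1..n}"
    by (rule image_cong) (simp_all add: path_vertex_def)
  moreover have "path_vertex n 0 = VA" "path_vertex n (Suc n) = VD"
    by (simp_all add: path_vertex_def)
  ultimately show ?thesis
    by (simp only: image_Un image_insert image_empty)
qed

text \<open>The assumption \<open>n \<ge> 1\<close> keeps the two ends of the path apart: for
  \<open>n = 0\<close> the adjacent vertices \<open>VA\<close> and \<open>VD\<close> would have
  consecutive numbers.\<close>

lemma path_vertex_edge_iff:
  assumes "n \<ge> 1" "i < j" "j \<le> Suc n"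
  shows "{path_vertex n i, path_vertex n j} \<in> G7_edges n \<longleftrightarrow> j \<noteq> Suc i"
proof (cases "0 < i \<and> j \<noteq> Suc n \<and> j \<noteq> Suc i")
  case True
  then have "i \<in> {1..n}" "j \<in> {1..n}" "\<bar>int i - int j\<bar> \<ge> 2"
    using assms by auto
  then have "{Num i, Num j} \<in> G7_edges n"
    by (simp add: G7_edges_def) metis
  then show ?thesis
    using True assms by (simp add: path_vertex_def)
next
  case False
  then show ?thesis
    using assms by (auto simp: path_vertex_def G7_edges_def doubleton_eq_iff)
qed

lemma G7_core_represented:
  assumes "n \<ge> 1"
  shows "\<exists>w. two_uniform_represents w (insert VX (path_vertex n ` {..Suc n})) (G7_edges n)"
proof -
  let ?f = "path_vertex n" and ?E = "G7_edges n"
  define p where "p = VX # map ?f (zigzag n @ [Suc n])"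
  define q where "q = VX # map ?f (zigzag (Suc n))"
  let ?V = "insert VX (?f ` {..Suc n})"
  have X: "?f k \<noteq> VX" for k
    by (simp add: path_vertex_def)
  have sets: "set p = ?V" "set q = ?V"
    by (auto simp: p_def q_def set_zigzag atMost_Suc)
  have dist: "distinct p" "distinct q"
    using X by (auto simp: p_def q_def distinct_map set_zigzag distinct_zigzag
        inj_on_subset[OF inj_path_vertex] inj_eq[OF inj_path_vertex] X[symmetric])
  have alt: "alternate (p @ q) i j \<longleftrightarrow> restrict_word p i j = restrict_word q i j"
    if "i \<in> ?V" "j \<in> ?V" "i \<noteq> j" for i j
    using that dist sets by (intro alternate_permutations) auto
  have path: "{?f i, ?f j} \<in> ?E \<longleftrightarrow> alternate (p @ q) (?f i) (?f j)" if "i < j" "j \<le> Suc n" for i j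
  proof -
    have "?f i \<noteq> ?f j"
      using that injD[OF inj_path_vertex, of n i j] by auto
    then have "alternate (p @ q) (?f i) (?f j) \<longleftrightarrow>
        restrict_word p (?f i) (?f j) = restrict_word q (?f i) (?f j)"
      using that by (intro alt) auto
    also have "\<dots> \<longleftrightarrow> restrict_word (map ?f (zigzag n @ [Suc n])) (?f i) (?f j)
        = restrict_word (map ?f (zigzag (Suc n))) (?f i) (?f j)"
      using X[of i] X[of j] by (simp add: restrict_word_def p_def q_def)
    \<comment> \<open>Injectivity of the numbering carries the comparison of orders from vertices
      back to numbers.\<close>
    also have "\<dots> \<longleftrightarrow> restrict_word (zigzag n @ [Suc n]) i j = restrict_word (zigzag (Suc n)) i j"
      using inj_path_vertex[of n]
      by (simp only: restrict_word_map[OF inj_on_subset[OF inj_path_vertex subset_UNIV]]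
          inj_map_eq_map)
    also have "\<dots> \<longleftrightarrow> {?f i, ?f j} \<in> ?E"
      using that assms by (simp add: zigzag_agree_iff path_vertex_edge_iff)
    finally show ?thesis by simp
  qed
  have star: "{VX, ?f j} \<in> ?E \<longleftrightarrow> alternate (p @ q) VX (?f j)" if "j \<le> Suc n" for j
  proof -
    have "{VX, ?f j} \<in> ?E"
      using that by (auto simp: path_vertex_def G7_edges_def doubleton_eq_iff)
    \<comment> \<open>\<open>VX\<close> heads both permutations, which excludes the order
      \<open>[?f j, VX]\<close>; so the two orders agree.\<close>
    moreover have "restrict_word r VX (?f j) = [VX, ?f j]" if "r = p \<or> r = q" for r
    proof -
      have r: "distinct r" "?f j \<in> set r" "VX \<in> set r" "hd (restrict_word r VX (?f j)) = VX"
        using dist sets \<open>j \<le> Suc n\<close> that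
        by (auto simp: p_def q_def restrict_word_def)
      show ?thesis
        using restrict_word_distinct[of r VX "?f j"] r X[of j] by auto
    qed
    ultimately show ?thesis
      using alt[of VX "?f j"] X[of j] that by force
  qed
  have "{i, j} \<in> ?E \<longleftrightarrow> alternate (p @ q) i j"
    if ij: "i \<in> ?V" "j \<in> ?V" "i \<noteq> j" for i j
  proof -
    consider "i = VX" | "j = VX" | "i \<noteq> VX" "j \<noteq> VX" by blast
    then show ?thesis
    proof cases
      case 1
      then obtain k where "k \<le> Suc n" "j = ?f k"
        using ij by auto
      with 1 show ?thesis
        using star by simp
    next
      case 2
      then obtain k where "k \<le> Suc n" "i = ?f k"
        using ij by auto
      with 2 show ?thesis
        using star[of k] by (simp only: insert_commute[of VX] alternate_commute[of _ VX])
    next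
      case 3
      then obtain k l where kl: "k \<le> Suc n" "l \<le> Suc n" "i = ?f k" "j = ?f l"
        using ij by (elim insertE imageE) simp_all
      with \<open>i \<noteq> j\<close> consider "k < l" | "l < k"
        by (metis linorder_neqE_nat)
      then show ?thesis
        using path[of k l] path[of l k] kl
        by cases (simp_all only: insert_commute[of "?f k"] alternate_commute[of _ "?f k"])
    qed
  qed
  moreover have "count_list (p @ q) k = 2" if "k \<in> ?V" for k
    using that dist sets by (simp add: count_list_distinct)
  ultimately have "two_uniform_represents (p @ q) ?V ?E"
    using sets by (simp add: two_uniform_represents_def)
  then show ?thesis by blast
qed

lemma G7_edge_VC_iff: "{v, VC} \<in> G7_edges n \<longleftrightarrow> v = VA"
  by (simp add: G7_edges_def doubleton_eq_iff)

lemma G7_edge_VB_iff: "{v, VB} \<in> G7_edges n \<longleftrightarrow> v = VD"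
  by (simp add: G7_edges_def doubleton_eq_iff)

theorem theorem7:
  fixes n :: nat
  assumes "n \<ge> 1"
  shows "word_representable (G7_verts n) (G7_edges n)"
proof -
  let ?V = "insert VX (path_vertex n ` {..Suc n})"
  have verts: "G7_verts n = insert VB (insert VC ?V)"
    by (auto simp: G7_verts_def path_vertex_image)
  have VA: "VA \<in> ?V" and VD: "VD \<in> ?V" and new: "VC \<notin> ?V" "VB \<notin> ?V"
    by (auto simp: path_vertex_image)
  obtain w where "two_uniform_represents w ?V (G7_edges n)"
    using G7_core_represented[OF assms] by blast
  \<comment> \<open>First \<open>VC\<close> is hung at \<open>VA\<close>, then \<open>VB\<close> at
    \<open>VD\<close>. Since \<open>VB\<close> and \<open>VC\<close> are not adjacent,
    \<open>VD\<close> is still the only neighbour of \<open>VB\<close> in the enlarged vertex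
    set.\<close>
  from two_uniform_represents_pendant[OF this VA new(1) G7_edge_VC_iff]
  obtain w' where w': "two_uniform_represents w' (insert VC ?V) (G7_edges n)"
    by blast
  have "VD \<in> insert VC ?V" "VB \<notin> insert VC ?V"
    using VD new(2) by simp_all
  from two_uniform_represents_pendant[OF w' this G7_edge_VB_iff]
  obtain w'' where "two_uniform_represents w'' (G7_verts n) (G7_edges n)"
    unfolding verts by blast
  then show ?thesis
    by (rule two_uniform_represents_imp_word_representable)
qed

end
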